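(* The field $I_F$ of geometric invariants of plane curves is generated over $\mathbb{C}$ by the variables $x^{(0)},y^{(0)}$, the slope $\kappa_0$ and the first and higher algebraic curvatures $\kappa_i$, $i\ge 1$, i.e. $$I_F=\mathbb{C}(x^{(0)},y^{(0)},\kappa_i : i\in\mathbb{N}).$$
   Context: $\mathbb{N}=\{0,1,2,\dots\}$. Let $x^{(i)},y^{(i)},\varphi^{(i)}$ ($i\in\mathbb{N}$) be independent variables, $F=\mathbb{C}(x^{(i)},y^{(i)} : i\in\mathbb{N})$ and $L=F(\varphi^{(i)} : i\in\mathbb{N})$. Let $\partial$ be the $\mathbb{C}$-derivation of $L$ with $\partial x^{(i)}=x^{(i+1)}$, $\partial y^{(i)}=y^{(i+1)}$, $\partial\varphi^{(i)}=\varphi^{(i+1)}$ (it restricts to $F$), and $\chi$ the $\mathbb{C}$-derivation of $L$ with $\chi(x^{(i)})=x^{(i+1)}\varphi^{(1)}$, $\chi(y^{(i)})=y^{(i+1)}\varphi^{(1)}$, $\chi(\varphi^{(i)})=\varphi^{(i+1)}$. Let $\Lambda:L\to L$ be the $\mathbb{C}$-algebra homomorphism of fields with $\Lambda(x^{(i)})=\chi^i(x^{(0)})$, $\Lambda(y^{(i)})=\chi^i(y^{(0)})$, $\Lambda(\varphi^{(i)})=\chi^i(\varphi^{(0)})=\varphi^{(i)}$, where $\chi^i$ is the $i$-fold composition. An element $p\in F$ is a geometric invariant of plane curves if $\Lambda(p)=p$; $I_F=\{p\in F:\Lambda(p)=p\}$ is a subfield of $F$. The slope and algebraic curvatures are $$\kappa_0=\frac{y^{(1)}}{x^{(1)}},\qquad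 \kappa_1=\frac{y^{(2)}x^{(1)}-y^{(1)}x^{(2)}}{(x^{(1)})^3},\qquad \kappa_{i+1}=\frac{\partial(\kappa_i)}{x^{(1)}}\ (i\ge1).$$ *)

theory Defs
  imports Complex_Main "HOL-Library.Poly_Mapping" "HOL-Computational_Algebra.Fraction_Field"
begin

section \<open>The field of rational functions\<close>

datatype jet_var = Vx nat | Vy nat | Vphi nat

text \<open>The linear order on the variables is arbitrary. It only serves the type class instance
  that makes the polynomial ring an integral domain.\<close>

fun jet_var_code :: "jet_var \<Rightarrow> nat" where
  "jet_var_code (Vx i) = 3 * i"
| "jet_var_code (Vy i) = 3 * i + 1"
| "jet_var_code (Vphi i) = 3 * i + 2"

lemma jet_var_code_inject: "jet_var_code v = jet_var_code w \<Longrightarrow> v = w"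
  by (cases v; cases w; simp; presburger)

instantiation jet_var :: linorder
begin

definition less_eq_jet_var :: "jet_var \<Rightarrow> jet_var \<Rightarrow> bool" where
  "v \<le> w \<longleftrightarrow> jet_var_code v \<le> jet_var_code w"

definition less_jet_var :: "jet_var \<Rightarrow> jet_var \<Rightarrow> bool" where
  "v < w \<longleftrightarrow> jet_var_code v < jet_var_code w"

instance
  by standard (auto simp: less_eq_jet_var_def less_jet_var_def intro: jet_var_code_inject)

end

text \<open>Monomials are finitely supported exponent functions, polynomials are finitely supported
  coefficient functions on the monomials. Multiplication of the latter is convolution.\<close>

type_synonym jet_poly = "(jet_var \<Rightarrow>\<^sub>0 nat) \<Rightarrow>\<^sub>0 complex"

type_synonym L = "jet_poly fract"

definition emb :: "jet_poly \<Rightarrow> L" where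
  "emb p = Fract p 1"

definition const :: "complex \<Rightarrow> L" where
  "const c = emb (Poly_Mapping.single 0 c)"

definition gen :: "jet_var \<Rightarrow> L" where
  "gen v = emb (Poly_Mapping.single (Poly_Mapping.single v 1) 1)"

definition x_jet :: "nat \<Rightarrow> L" where "x_jet i = gen (Vx i)"
definition y_jet :: "nat \<Rightarrow> L" where "y_jet i = gen (Vy i)"
definition phi_jet :: "nat \<Rightarrow> L" where "phi_jet i = gen (Vphi i)"

definition is_subfield :: "L set \<Rightarrow> bool" where
  "is_subfield K \<longleftrightarrow> 0 \<in> K \<and> 1 \<in> K \<and>
     (\<forall>a\<in>K. \<forall>b\<in>K. a + b \<in> K \<and> a * b \<in> K) \<and> (\<forall>a\<in>K. - a \<in> K \<and> inverse a \<in> K)"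

text \<open>The subfield of \<open>L\<close> generated over the complex numbers by a set \<open>S\<close>.\<close>

definition adjoin :: "L set \<Rightarrow> L set" where
  "adjoin S = \<Inter> {K. is_subfield K \<and> range const \<subseteq> K \<and> S \<subseteq> K}"

definition F :: "L set" where
  "F = adjoin (range x_jet \<union> range y_jet)"


section \<open>Derivations and homomorphisms over the complex numbers\<close>

definition is_derivation :: "(L \<Rightarrow> L) \<Rightarrow> bool" where
  "is_derivation D \<longleftrightarrow> (\<forall>a b. D (a + b) = D a + D b) \<and>
     (\<forall>a b. D (a * b) = D a * b + a * D b) \<and> (\<forall>c. D (const c) = 0)"

definition is_alg_hom :: "(L \<Rightarrow> L) \<Rightarrow> bool" where
  "is_alg_hom h \<longleftrightarrow> (\<forall>a b. h (a + b) = h a + h b) \<and>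
     (\<forall>a b. h (a * b) = h a * h b) \<and> (\<forall>c. h (const c) = const c)"

text \<open>The following three descriptions are justified by the lemmas \<open>partial_ex1\<close>, \<open>chi_ex1\<close> and
  \<open>Lam_ex1\<close> below.\<close>

definition partial :: "L \<Rightarrow> L" where
  "partial = (THE D. is_derivation D \<and>
     (\<forall>i. D (x_jet i) = x_jet (Suc i)) \<and>
     (\<forall>i. D (y_jet i) = y_jet (Suc i)) \<and>
     (\<forall>i. D (phi_jet i) = phi_jet (Suc i)))"

definition chi :: "L \<Rightarrow> L" where
  "chi = (THE D. is_derivation D \<and>
     (\<forall>i. D (x_jet i) = x_jet (Suc i) * phi_jet 1) \<and>
     (\<forall>i. D (y_jet i) = y_jet (Suc i) * phi_jet 1) \<and>
     (\<forall>i. D (phi_jet i) = phi_jet (Suc i)))"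

definition Lam :: "L \<Rightarrow> L" where
  "Lam = (THE h. is_alg_hom h \<and>
     (\<forall>i. h (x_jet i) = (chi ^^ i) (x_jet 0)) \<and>
     (\<forall>i. h (y_jet i) = (chi ^^ i) (y_jet 0)) \<and>
     (\<forall>i. h (phi_jet i) = (chi ^^ i) (phi_jet 0)))"


section \<open>Geometric invariants and curvatures\<close>

definition I_F :: "L set" where
  "I_F = {p \<in> F. Lam p = p}"

fun kappa :: "nat \<Rightarrow> L" where
  "kappa 0 = y_jet 1 / x_jet 1"
| "kappa (Suc 0) = (y_jet 2 * x_jet 1 - y_jet 1 * x_jet 2) / x_jet 1 ^ 3"
| "kappa (Suc (Suc i)) = partial (kappa (Suc i)) / x_jet 1"


section \<open>Existence and uniqueness of the derivations and of the homomorphism\<close>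

lemma emb_simps [simp]:
  "emb 0 = 0" "emb 1 = 1" "emb (p + q) = emb p + emb q" "emb (p * q) = emb p * emb q"
  "emb p = emb q \<longleftrightarrow> p = q"
  by (simp_all add: emb_def fract_collapse eq_fract)

lemma emb_eq_0_iff [simp]: "emb p = 0 \<longleftrightarrow> p = 0"
  using emb_simps(5)[of p 0] by (simp del: emb_simps(5))

lemma Fract_emb: "b \<noteq> 0 \<Longrightarrow> Fract a b = emb a / emb b"
  by (simp add: emb_def)

lemma L_cases: obtains a b where "q = emb a / emb b" "b \<noteq> 0"
  by (cases q) (auto simp: Fract_emb)

lemma gen_nonzero [simp]: "gen v \<noteq> 0"
  unfolding gen_def emb_eq_0_iff by (metis lookup_single_eq lookup_zero one_neq_zero)

lemma const_simps [simp]: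
  "const 0 = 0" "const 1 = 1" "const (a + b) = const a + const b" "const (a * b) = const a * const b"
proof -
  have "Poly_Mapping.single (0 :: jet_var \<Rightarrow>\<^sub>0 nat) (a * b) = Poly_Mapping.single 0 a * Poly_Mapping.single 0 b"
    by (simp add: mult_single)
  then show "const (a * b) = const a * const b" by (simp add: const_def)
qed (simp_all add: const_def single_add)

lemma poly_mapping_add_induct:
  fixes p :: "'a \<Rightarrow>\<^sub>0 'b::comm_monoid_add"
  assumes "\<And>k c. Q (Poly_Mapping.single k c)" "\<And>p q. Q p \<Longrightarrow> Q q \<Longrightarrow> Q (p + q)"
  shows "Q p"
proof -
  have "Q (\<Sum>k\<in>A. Poly_Mapping.single k (Poly_Mapping.lookup p k))" if "finite A" for A
    using that
  proof induction
    case empty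
    show ?case using assms(1)[of undefined 0] by simp
  qed (simp add: assms)
  moreover have "p = (\<Sum>k\<in>Poly_Mapping.keys p. Poly_Mapping.single k (Poly_Mapping.lookup p k))"
    by (rule poly_mapping_eqI) (simp add: lookup_sum lookup_single when_def in_keys_iff)
  ultimately show ?thesis by (metis finite_keys)
qed

lemma jet_poly_induct:
  fixes p :: jet_poly
  assumes C: "\<And>c. Q (Poly_Mapping.single 0 c)"
    and V: "\<And>v. Q (Poly_Mapping.single (Poly_Mapping.single v 1) 1)"
    and A: "\<And>p q. Q p \<Longrightarrow> Q q \<Longrightarrow> Q (p + q)"
    and M: "\<And>p q. Q p \<Longrightarrow> Q q \<Longrightarrow> Q (p * q)"
  shows "Q p"
proof (rule poly_mapping_add_induct[where Q = Q])
  fix m :: "jet_var \<Rightarrow>\<^sub>0 nat" and c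
  have one: "Q (Poly_Mapping.single m 1)"
  proof (rule poly_mapping_add_induct[where Q = "\<lambda>m. Q (Poly_Mapping.single m 1)"])
    fix v and n :: nat
    show "Q (Poly_Mapping.single (Poly_Mapping.single v n) 1)"
    proof (induction n)
      case 0
      show ?case using C[of 1] by simp
    next
      case (Suc n)
      from M[OF V Suc, of v] show ?case
        by (simp add: mult_single flip: single_add)
    qed
  next
    fix m n :: "jet_var \<Rightarrow>\<^sub>0 nat"
    assume "Q (Poly_Mapping.single m 1)" "Q (Poly_Mapping.single n 1)"
    from M[OF this] show "Q (Poly_Mapping.single (m + n) 1)" by (simp add: mult_single)
  qed
  from M[OF C[of c] this] show "Q (Poly_Mapping.single m c)" by (simp add: mult_single)
qed (rule A)

text \<open>Evaluation of polynomials at arbitrary elements of \<open>L\<close>.\<close>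

definition eval_mon :: "(jet_var \<Rightarrow> L) \<Rightarrow> (jet_var \<Rightarrow>\<^sub>0 nat) \<Rightarrow> L" where
  "eval_mon s m = (\<Prod>v\<in>Poly_Mapping.keys m. s v ^ Poly_Mapping.lookup m v)"

definition eval_poly :: "(jet_var \<Rightarrow> L) \<Rightarrow> jet_poly \<Rightarrow> L" where
  "eval_poly s p = (\<Sum>m\<in>Poly_Mapping.keys p. const (Poly_Mapping.lookup p m) * eval_mon s m)"

lemma eval_mon_add: "eval_mon s (m + n) = eval_mon s m * eval_mon s n"
proof -
  let ?A = "Poly_Mapping.keys m \<union> Poly_Mapping.keys n"
  have *: "eval_mon s k = (\<Prod>v\<in>?A. s v ^ Poly_Mapping.lookup k v)" if "Poly_Mapping.keys k \<subseteq> ?A" for k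
    unfolding eval_mon_def using that by (intro prod.mono_neutral_left) (auto simp: in_keys_iff)
  show ?thesis
    by (subst (1 2 3) *) (auto simp: lookup_add power_add prod.distrib dest: subsetD[OF keys_add])
qed

lemma eval_poly_single: "eval_poly s (Poly_Mapping.single m c) = const c * eval_mon s m"
  by (cases "c = 0") (simp_all add: eval_poly_def)

lemma eval_poly_add: "eval_poly s (p + q) = eval_poly s p + eval_poly s q"
proof -
  let ?A = "Poly_Mapping.keys p \<union> Poly_Mapping.keys q"
  have *: "eval_poly s k = (\<Sum>m\<in>?A. const (Poly_Mapping.lookup k m) * eval_mon s m)" if "Poly_Mapping.keys k \<subseteq> ?A" for k
    unfolding eval_poly_def using that by (intro sum.mono_neutral_left) (auto simp: in_keys_iff)
  show ?thesis
    by (subst (1 2 3) *) (auto simp: lookup_add sum.distrib algebra_simps dest: subsetD[OF keys_add])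
qed

lemma eval_poly_mult: "eval_poly s (p * q) = eval_poly s p * eval_poly s q"
proof (induction p rule: poly_mapping_add_induct)
  case (1 m c)
  show ?case
  proof (induction q rule: poly_mapping_add_induct)
    case (1 n d)
    show ?case by (simp add: mult_single eval_poly_single eval_mon_add)
  qed (simp add: eval_poly_add algebra_simps)
qed (simp add: eval_poly_add algebra_simps)

lemma eval_poly_const: "eval_poly s (Poly_Mapping.single 0 c) = const c"
  by (simp add: eval_poly_single eval_mon_def)

lemma eval_poly_var: "eval_poly s (Poly_Mapping.single (Poly_Mapping.single v 1) 1) = s v"
  by (simp add: eval_poly_single eval_mon_def)

lemma alg_hom_ex1:
  assumes inj: "\<And>p. eval_poly s p = 0 \<Longrightarrow> p = 0"
  shows "\<exists>!h. is_alg_hom h \<and> (\<forall>v. h (gen v) = s v)"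
proof (rule ex_ex1I)
  define h where "h q = (THE z. \<exists>a b. b \<noteq> 0 \<and> q = emb a / emb b \<and> z = eval_poly s a / eval_poly s b)" for q
  have h: "h (emb a / emb b) = eval_poly s a / eval_poly s b" if "b \<noteq> 0" for a b
    unfolding h_def
  proof (rule the_equality)
    fix z assume "\<exists>a' b'. b' \<noteq> 0 \<and> emb a / emb b = emb a' / emb b' \<and> z = eval_poly s a' / eval_poly s b'"
    then obtain a' b' where b': "b' \<noteq> 0" and eq: "emb a / emb b = emb a' / emb b'"
      and z: "z = eval_poly s a' / eval_poly s b'" by blast
    from eq b' that have "emb (a * b') = emb (a' * b)" by (simp add: frac_eq_eq)
    then have "eval_poly s a * eval_poly s b' = eval_poly s a' * eval_poly s b"
      by (metis emb_simps(5) eval_poly_mult)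
    then show "z = eval_poly s a / eval_poly s b"
      using inj b' that z by (metis frac_eq_eq)
  qed (use that in blast)
  have h_emb: "h (emb p) = eval_poly s p" for p
    using h[of 1 p] eval_poly_const[of s 1] by simp
  have "is_alg_hom h"
    unfolding is_alg_hom_def
  proof (intro conjI allI)
    fix p q :: L
    obtain a b where p: "p = emb a / emb b" "b \<noteq> 0" by (rule L_cases)
    obtain c d where q: "q = emb c / emb d" "d \<noteq> 0" by (rule L_cases)
    have nz: "eval_poly s b \<noteq> 0" "eval_poly s d \<noteq> 0" using inj p q by blast+
    have "p + q = emb (a * d + c * b) / emb (b * d)" using p q by (simp add: add_frac_eq)
    then have "h (p + q) = eval_poly s (a * d + c * b) / eval_poly s (b * d)"
      using h[of "b * d" "a * d + c * b"] p q by simp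
    then show "h (p + q) = h p + h q"
      using nz p q by (simp add: eval_poly_add eval_poly_mult add_frac_eq h)
    have "p * q = emb (a * c) / emb (b * d)" using p q by simp
    then have "h (p * q) = eval_poly s (a * c) / eval_poly s (b * d)"
      using h[of "b * d" "a * c"] p q by simp
    then show "h (p * q) = h p * h q"
      using p q by (simp add: eval_poly_mult h)
  qed (simp add: const_def h_emb eval_poly_const)
  then show "\<exists>h. is_alg_hom h \<and> (\<forall>v. h (gen v) = s v)"
    by (intro exI[of _ h]) (use eval_poly_var[of s] in \<open>simp add: gen_def h_emb\<close>)
next
  fix g h assume "is_alg_hom g \<and> (\<forall>v. g (gen v) = s v)" "is_alg_hom h \<and> (\<forall>v. h (gen v) = s v)"
  then have g: "g (a + b) = g a + g b" "g (a * b) = g a * g b" "g (const c) = const c" "g (gen v) = s v"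
    and h: "h (a + b) = h a + h b" "h (a * b) = h a * h b" "h (const c) = const c" "h (gen v) = s v"
    for a b c v by (auto simp: is_alg_hom_def)
  have eq: "g (emb p) = h (emb p)" for p
    by (induction p rule: jet_poly_induct) (simp_all add: g h del: One_nat_def flip: const_def gen_def)
  show "g = h"
  proof
    fix q :: L
    obtain a b where q: "q = emb a / emb b" "b \<noteq> 0" by (rule L_cases)
    have "g (emb b) * g (inverse (emb b)) = 1" "h (emb b) * h (inverse (emb b)) = 1"
      using q g(3)[of 1] h(3)[of 1] by (simp_all flip: g(2) h(2))
    then have "g (inverse (emb b)) = h (inverse (emb b))"
      using eq[of b] by (metis inverse_unique)
    then show "g q = h q" using eq q by (simp add: divide_inverse g h)
  qed
qed

text \<open>Derivations are built from the logarithmic derivative of monomials.\<close>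

lemma quot_add:
  fixes b e :: "'a::field"
  assumes "b \<noteq> 0" "e \<noteq> 0"
  shows "((a' * e + a * e' + (c' * b + c * b')) * (b * e) - (a * e + c * b) * (b' * e + b * e')) / (b * e)^2 =
    (a' * b - a * b') / b^2 + (c' * e - c * e') / e^2"
proof -
  have "(a' * b - a * b') / b^2 + (c' * e - c * e') / e^2 =
    ((a' * b - a * b') * e^2 + (c' * e - c * e') * b^2) / (b^2 * e^2)"
    using assms by (intro add_frac_eq) simp_all
  also have "\<dots> = ((a' * e + a * e' + (c' * b + c * b')) * (b * e) - (a * e + c * b) * (b' * e + b * e')) / (b * e)^2"
    by (rule arg_cong2[where f = divide]) (simp_all add: algebra_simps power2_eq_square)
  finally show ?thesis ..
qed

lemma quot_mult:
  fixes b e :: "'a::field"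
  assumes "b \<noteq> 0" "e \<noteq> 0"
  shows "((a' * c + a * c') * (b * e) - a * c * (b' * e + b * e')) / (b * e)^2 =
    (a' * b - a * b') / b^2 * (c / e) + a / b * ((c' * e - c * e') / e^2)"
proof -
  have *: "c / e = c * e / e^2" "a / b = a * b / b^2"
    using assms by (simp_all add: power2_eq_square)
  have "(a' * b - a * b') / b^2 * (c / e) + a / b * ((c' * e - c * e') / e^2) =
    ((a' * b - a * b') * (c * e) + a * b * (c' * e - c * e')) / (b^2 * e^2)"
    unfolding * by (simp add: add_divide_distrib)
  also have "\<dots> = ((a' * c + a * c') * (b * e) - a * c * (b' * e + b * e')) / (b * e)^2"
    by (rule arg_cong2[where f = divide]) (simp_all add: algebra_simps power2_eq_square)
  finally show ?thesis ..
qed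

lemma derivation_ex1: "\<exists>!D. is_derivation D \<and> (\<forall>v. D (gen v) = f v)"
proof (rule ex_ex1I)
  define ld where "ld m = (\<Sum>v\<in>Poly_Mapping.keys m. of_nat (Poly_Mapping.lookup m v) * (f v / gen v))" for m :: "jet_var \<Rightarrow>\<^sub>0 nat"
  define d where "d p = (\<Sum>m\<in>Poly_Mapping.keys p. emb (Poly_Mapping.single m (Poly_Mapping.lookup p m)) * ld m)" for p :: jet_poly
  have ld_add: "ld (m + n) = ld m + ld n" for m n
  proof -
    let ?A = "Poly_Mapping.keys m \<union> Poly_Mapping.keys n"
    have *: "ld k = (\<Sum>v\<in>?A. of_nat (Poly_Mapping.lookup k v) * (f v / gen v))" if "Poly_Mapping.keys k \<subseteq> ?A" for k
      unfolding ld_def using that by (intro sum.mono_neutral_left) (auto simp: in_keys_iff)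
    show ?thesis
      by (subst (1 2 3) *) (auto simp: lookup_add sum.distrib algebra_simps add_divide_distrib dest: subsetD[OF keys_add])
  qed
  have d_add: "d (p + q) = d p + d q" for p q
  proof -
    let ?A = "Poly_Mapping.keys p \<union> Poly_Mapping.keys q"
    have *: "d k = (\<Sum>m\<in>?A. emb (Poly_Mapping.single m (Poly_Mapping.lookup k m)) * ld m)" if "Poly_Mapping.keys k \<subseteq> ?A" for k
      unfolding d_def using that by (intro sum.mono_neutral_left) (auto simp: in_keys_iff)
    show ?thesis
      by (subst (1 2 3) *) (auto simp: lookup_add single_add sum.distrib algebra_simps dest: subsetD[OF keys_add])
  qed
  have d_single: "d (Poly_Mapping.single m c) = emb (Poly_Mapping.single m c) * ld m" for m c
    by (cases "c = 0") (simp_all add: d_def)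
  have d_mult: "d (p * q) = d p * emb q + emb p * d q" for p q
  proof (induction p rule: poly_mapping_add_induct)
    case (1 m c)
    show ?case
    proof (induction q rule: poly_mapping_add_induct)
      case (1 n e)
      have "d (Poly_Mapping.single m c * Poly_Mapping.single n e) =
        emb (Poly_Mapping.single m c * Poly_Mapping.single n e) * (ld m + ld n)"
        by (simp only: mult_single d_single ld_add)
      then show ?case by (simp add: d_single algebra_simps)
    qed (simp add: d_add algebra_simps)
  qed (simp add: d_add algebra_simps)
  define D where "D q = (THE z. \<exists>a b. b \<noteq> 0 \<and> q = emb a / emb b \<and>
    z = (d a * emb b - emb a * d b) / emb b ^ 2)" for q
  have D: "D (emb a / emb b) = (d a * emb b - emb a * d b) / emb b ^ 2" if "b \<noteq> 0" for a b
    unfolding D_def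
  proof (rule the_equality)
    fix z assume "\<exists>a' b'. b' \<noteq> 0 \<and> emb a / emb b = emb a' / emb b' \<and>
      z = (d a' * emb b' - emb a' * d b') / emb b' ^ 2"
    then obtain a' b' where b': "b' \<noteq> 0" and eq: "emb a / emb b = emb a' / emb b'"
      and z: "z = (d a' * emb b' - emb a' * d b') / emb b' ^ 2" by blast
    from eq b' that have e1: "emb a * emb b' = emb a' * emb b" by (simp add: frac_eq_eq)
    then have "a * b' = a' * b" by (metis emb_simps(4,5))
    then have "d (a * b') = d (a' * b)" by simp
    then have e2: "d a * emb b' + emb a * d b' = d a' * emb b + emb a' * d b" by (simp add: d_mult)
    have "(d a' * emb b' - emb a' * d b') * emb b ^ 2 = (d a * emb b - emb a * d b) * emb b' ^ 2"
      using e1 e2 by algebra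
    then show "z = (d a * emb b - emb a * d b) / emb b ^ 2"
      using b' that z by (simp add: frac_eq_eq)
  qed (use that in blast)
  have d1: "d 1 = 0"
    using d_mult[of 1 1] by (simp only: emb_simps mult_1_left mult_1_right mult_1) (metis add_cancel_right_right)
  have D_emb: "D (emb p) = d p" for p
    using D[of 1 p] d1 by simp
  have "is_derivation D"
    unfolding is_derivation_def
  proof (intro conjI allI)
    fix p q :: L
    obtain a b where p: "p = emb a / emb b" "b \<noteq> 0" by (rule L_cases)
    obtain c e where q: "q = emb c / emb e" "e \<noteq> 0" by (rule L_cases)
    have "p + q = emb (a * e + c * b) / emb (b * e)" using p q by (simp add: add_frac_eq)
    then have "D (p + q) = (d (a * e + c * b) * emb (b * e) - emb (a * e + c * b) * d (b * e)) / emb (b * e) ^ 2"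
      using D[of "b * e" "a * e + c * b"] p q by simp
    then show "D (p + q) = D p + D q"
      using p q by (simp add: D d_add d_mult quot_add)
    have "p * q = emb (a * c) / emb (b * e)" using p q by simp
    then have "D (p * q) = (d (a * c) * emb (b * e) - emb (a * c) * d (b * e)) / emb (b * e) ^ 2"
      using D[of "b * e" "a * c"] p q by simp
    then show "D (p * q) = D p * q + p * D q"
      using p q by (simp add: D d_mult quot_mult)
  next
    show "D (const c) = 0" for c by (simp add: const_def D_emb d_single) (simp add: ld_def)
  qed
  moreover have "D (gen v) = f v" for v
  proof -
    have "D (gen v) = gen v * ld (Poly_Mapping.single v 1)"
      unfolding gen_def D_emb d_single ..
    then show ?thesis by (simp add: ld_def)
  qed
  ultimately show "\<exists>D. is_derivation D \<and> (\<forall>v. D (gen v) = f v)" by blast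
next
  fix g h assume "is_derivation g \<and> (\<forall>v. g (gen v) = f v)" "is_derivation h \<and> (\<forall>v. h (gen v) = f v)"
  then have g: "g (a + b) = g a + g b" "g (a * b) = g a * b + a * g b" "g (const c) = 0" "g (gen v) = f v"
    and h: "h (a + b) = h a + h b" "h (a * b) = h a * b + a * h b" "h (const c) = 0" "h (gen v) = f v"
    for a b c v by (auto simp: is_derivation_def)
  have eq: "g (emb p) = h (emb p)" for p
    by (induction p rule: jet_poly_induct) (simp_all add: g h del: One_nat_def flip: const_def gen_def)
  show "g = h"
  proof
    fix q :: L
    obtain a b where q: "q = emb a / emb b" "b \<noteq> 0" by (rule L_cases)
    then have "q * emb b = emb a" by simp
    then have "g q * emb b + q * g (emb b) = h q * emb b + q * h (emb b)"
      using eq by (metis g(2) h(2))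
    then show "g q = h q" using eq q by simp
  qed
qed

lemma all_jet_var: "(\<forall>v. Q v) \<longleftrightarrow> (\<forall>i. Q (Vx i)) \<and> (\<forall>i. Q (Vy i)) \<and> (\<forall>i. Q (Vphi i))"
proof (intro iffI allI)
  fix v assume "(\<forall>i. Q (Vx i)) \<and> (\<forall>i. Q (Vy i)) \<and> (\<forall>i. Q (Vphi i))"
  then show "Q v" by (cases v) simp_all
qed blast

lemma partial_ex1:
  "\<exists>!D. is_derivation D \<and> (\<forall>i. D (x_jet i) = x_jet (Suc i)) \<and>
     (\<forall>i. D (y_jet i) = y_jet (Suc i)) \<and> (\<forall>i. D (phi_jet i) = phi_jet (Suc i))"
  using derivation_ex1[of "case_jet_var (\<lambda>i. x_jet (Suc i)) (\<lambda>i. y_jet (Suc i)) (\<lambda>i. phi_jet (Suc i))"]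
  unfolding all_jet_var jet_var.case x_jet_def y_jet_def phi_jet_def .

lemma chi_ex1:
  "\<exists>!D. is_derivation D \<and> (\<forall>i. D (x_jet i) = x_jet (Suc i) * phi_jet 1) \<and>
     (\<forall>i. D (y_jet i) = y_jet (Suc i) * phi_jet 1) \<and> (\<forall>i. D (phi_jet i) = phi_jet (Suc i))"
  using derivation_ex1[of "case_jet_var (\<lambda>i. x_jet (Suc i) * phi_jet 1)
    (\<lambda>i. y_jet (Suc i) * phi_jet 1) (\<lambda>i. phi_jet (Suc i))"]
  unfolding all_jet_var jet_var.case x_jet_def y_jet_def phi_jet_def .

lemmas partial_props = theI'[OF partial_ex1, folded partial_def]
lemmas chi_props = theI'[OF chi_ex1, folded chi_def]

lemma chi_iterate_phi: "(chi ^^ i) (phi_jet 0) = phi_jet i"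
  using chi_props by (induction i) simp_all

lemma Lam_ex1:
  "\<exists>!h. is_alg_hom h \<and> (\<forall>i. h (x_jet i) = (chi ^^ i) (x_jet 0)) \<and>
     (\<forall>i. h (y_jet i) = (chi ^^ i) (y_jet 0)) \<and> (\<forall>i. h (phi_jet i) = (chi ^^ i) (phi_jet 0))"
proof -
  define s where "s = case_jet_var (\<lambda>i. (chi ^^ i) (x_jet 0)) (\<lambda>i. (chi ^^ i) (y_jet 0)) (\<lambda>i. (chi ^^ i) (phi_jet 0))"
  define psi where "psi z = partial z / phi_jet 1" for z
  define t where "t = case_jet_var (\<lambda>i. (psi ^^ i) (x_jet 0)) (\<lambda>i. (psi ^^ i) (y_jet 0)) phi_jet"
  let ?T = "eval_poly t"
  have phi1: "phi_jet 1 \<noteq> 0" by (simp add: phi_jet_def)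
  note der = chi_props partial_props
  have chiD: "chi (a + b) = chi a + chi b" "chi (a * b) = chi a * b + a * chi b" "chi (const c) = 0"
    and parD: "partial (a + b) = partial a + partial b" "partial (a * b) = partial a * b + a * partial b"
      "partial (const c) = 0" for a b c
    using der by (simp_all add: is_derivation_def)
  let ?V = "\<lambda>v. Poly_Mapping.single (Poly_Mapping.single v 1) 1 :: jet_poly"
  have embV: "emb (?V v) = gen v" for v by (simp add: gen_def)
  have TV: "?T (?V v) = t v" for v by (rule eval_poly_var)
  \<comment> \<open>\<open>t\<close> inverts \<open>s\<close> on polynomials, because it turns \<open>chi\<close> into \<open>partial\<close>.\<close>
  have chi_T: "\<exists>q. chi (emb p) = emb q \<and> ?T q = partial (?T p)" for p
  proof (induction p rule: jet_poly_induct)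
    case (1 c)
    show ?case
      by (rule exI[of _ 0]) (use eval_poly_const[of t 0] in \<open>simp add: eval_poly_const chiD parD flip: const_def\<close>)
  next
    case (2 v)
    show ?case
    proof (cases v)
      case (Vx i)
      show ?thesis
        by (rule exI[of _ "?V (Vx (Suc i)) * ?V (Vphi 1)"])
          (use phi1 der in \<open>simp only: embV TV eval_poly_mult emb_simps Vx, simp add: t_def psi_def x_jet_def phi_jet_def\<close>)
    next
      case (Vy i)
      show ?thesis
        by (rule exI[of _ "?V (Vy (Suc i)) * ?V (Vphi 1)"])
          (use phi1 der in \<open>simp only: embV TV eval_poly_mult emb_simps Vy, simp add: t_def psi_def y_jet_def phi_jet_def\<close>)
    next
      case (Vphi i)
      show ?thesis
        by (rule exI[of _ "?V (Vphi (Suc i))"])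
          (use der in \<open>simp only: embV TV Vphi, simp add: t_def phi_jet_def\<close>)
    qed
  next
    case (3 p q)
    then show ?case by (metis chiD(1) parD(1) emb_simps(3) eval_poly_add)
  next
    case (4 p q)
    then obtain p' q' where *: "chi (emb p) = emb p'" "?T p' = partial (?T p)"
      "chi (emb q) = emb q'" "?T q' = partial (?T q)" by blast
    show ?case
      by (rule exI[of _ "p' * q + p * q'"]) (simp add: * chiD parD eval_poly_add eval_poly_mult)
  qed
  have iter: "\<exists>q. (chi ^^ i) (emb p) = emb q \<and> ?T q = (partial ^^ i) (?T p)" for p i
  proof (induction i)
    case (Suc i)
    then show ?case by (metis chi_T comp_apply funpow.simps(2))
  qed auto
  have par_iter: "(partial ^^ i) (gen (Vx 0)) = gen (Vx i)" "(partial ^^ i) (gen (Vy 0)) = gen (Vy i)" for i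
    using der by (induction i) (simp_all add: x_jet_def y_jet_def)
  have inv: "\<exists>q. eval_poly s p = emb q \<and> ?T q = emb p" for p
  proof (induction p rule: jet_poly_induct)
    case (1 c)
    show ?case
      by (rule exI[of _ "Poly_Mapping.single 0 c"]) (simp add: eval_poly_const flip: const_def)
  next
    case (2 v)
    show ?case
    proof (cases v)
      case (Vx i)
      have "?T (?V (Vx 0)) = gen (Vx 0)" unfolding TV by (simp add: t_def x_jet_def)
      then show ?thesis using iter[of i "?V (Vx 0)"]
        unfolding eval_poly_var embV by (simp add: Vx par_iter s_def x_jet_def)
    next
      case (Vy i)
      have "?T (?V (Vy 0)) = gen (Vy 0)" unfolding TV by (simp add: t_def y_jet_def)
      then show ?thesis using iter[of i "?V (Vy 0)"]
        unfolding eval_poly_var embV by (simp add: Vy par_iter s_def y_jet_def)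
    next
      case (Vphi i)
      show ?thesis
        by (rule exI[of _ "?V (Vphi i)"], unfold TV eval_poly_var embV)
          (simp add: Vphi s_def t_def chi_iterate_phi, simp add: phi_jet_def)
    qed
  next
    case (3 p q)
    then show ?case by (metis emb_simps(3) eval_poly_add)
  next
    case (4 p q)
    then show ?case by (metis emb_simps(4) eval_poly_mult)
  qed
  have "p = 0" if "eval_poly s p = 0" for p
    using inv[of p] that by (auto simp: eval_poly_def)
  then have "\<exists>!h. is_alg_hom h \<and> (\<forall>v. h (gen v) = s v)" by (rule alg_hom_ex1)
  then show ?thesis
    by (simp only: all_jet_var jet_var.case x_jet_def y_jet_def phi_jet_def s_def)
qed

lemmas Lam_props = theI'[OF Lam_ex1, folded Lam_def]

end

(*
  The curvatures are invariant because Lam intertwines partial with chi and chi equals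
  phi_1 partial on F, so that p |-> partial p / x_1 preserves invariance.

  Conversely, F is generated over K = C(x_0, y_0, kappa_i) by the x_i, i >= 1. An invariant p
  therefore equals Lam p, which lies in K(X_1, ..., X_N) for X_i = Lam x_i = x_1 phi_i + (terms
  in phi_1, ..., phi_(i-1)). The derivation E_n = (1/x_1) d/dphi_n annihilates F and
  X_1, ..., X_(n-1), and E_n X_n = 1. Since E_n p = 0, the generators X_N, ..., X_1 can be
  removed one after another, which leaves p in K.
*)

theory Submission
  imports Defs "HOL-Computational_Algebra.Polynomial"
begin

section \<open>Subfields\<close>

text \<open>In characteristic zero a polynomial with vanishing derivative is constant;
  \<open>transcendental_over_constants\<close> uses this over \<open>L\<close>.\<close>

instance fract :: ("{idom, ring_char_0}") ring_char_0
proof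
  show "inj (of_nat :: nat \<Rightarrow> 'a fract)"
    by (rule injI) (simp add: of_nat_fract eq_fract)
qed

lemma is_subfieldD:
  assumes "is_subfield K"
  shows "0 \<in> K" "1 \<in> K" "a \<in> K \<Longrightarrow> b \<in> K \<Longrightarrow> a + b \<in> K" "a \<in> K \<Longrightarrow> b \<in> K \<Longrightarrow> a * b \<in> K"
    "a \<in> K \<Longrightarrow> - a \<in> K" "a \<in> K \<Longrightarrow> inverse a \<in> K"
    "a \<in> K \<Longrightarrow> b \<in> K \<Longrightarrow> a / b \<in> K"
proof -
  show *: "0 \<in> K" "1 \<in> K" "a \<in> K \<Longrightarrow> b \<in> K \<Longrightarrow> a + b \<in> K" "a \<in> K \<Longrightarrow> b \<in> K \<Longrightarrow> a * b \<in> K"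
    "a \<in> K \<Longrightarrow> - a \<in> K" "a \<in> K \<Longrightarrow> inverse a \<in> K" for a b
    using assms by (simp_all add: is_subfield_def)
  show "a / b \<in> K" if "a \<in> K" "b \<in> K"
    using *(4)[OF that(1) *(6)[OF that(2)]] by (simp add: divide_inverse)
qed

lemma is_subfield_sum: "is_subfield K \<Longrightarrow> (\<And>i. i \<in> A \<Longrightarrow> f i \<in> K) \<Longrightarrow> sum f A \<in> K"
  by (induction A rule: infinite_finite_induct) (auto intro: is_subfieldD)

lemma is_subfield_adjoin: "is_subfield (adjoin S)"
  unfolding adjoin_def is_subfield_def by auto

lemmas adjoin_closed = is_subfieldD[OF is_subfield_adjoin]

lemma const_in_adjoin: "const c \<in> adjoin S"
  unfolding adjoin_def by auto

lemma adjoin_superset: "S \<subseteq> adjoin S"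
  unfolding adjoin_def by auto

lemma adjoin_least: "is_subfield K \<Longrightarrow> range const \<subseteq> K \<Longrightarrow> S \<subseteq> K \<Longrightarrow> adjoin S \<subseteq> K"
  unfolding adjoin_def by auto

lemma adjoin_subset_adjoin: "S \<subseteq> adjoin T \<Longrightarrow> adjoin S \<subseteq> adjoin T"
  by (rule adjoin_least) (auto simp: is_subfield_adjoin const_in_adjoin)

lemma adjoin_mono: "S \<subseteq> T \<Longrightarrow> adjoin S \<subseteq> adjoin T"
  using adjoin_subset_adjoin adjoin_superset by blast

text \<open>The fields \<open>A n\<close> increase with \<open>n\<close>, so any two elements of
  their union lie in a common one and the union is a subfield. Thus infinitely many generators can
  be removed by an induction on \<open>n\<close>.\<close>

lemma adjoin_union_range_finite:
  fixes f :: "nat \<Rightarrow> L"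
  assumes "p \<in> adjoin (S \<union> range f)"
  obtains n where "p \<in> adjoin (S \<union> f ` {..<n})"
proof -
  define A where "A n = adjoin (S \<union> f ` {..<n})" for n
  define U where "U = (\<Union>n. A n)"
  have UI: "a \<in> U" if "a \<in> A n" for a n
    using that unfolding U_def by blast
  have mono: "A m \<subseteq> A n" if "m \<le> n" for m n
    unfolding A_def by (rule adjoin_mono) (use that in auto)
  have common: "\<exists>n. a \<in> A n \<and> b \<in> A n" if ab: "a \<in> U" "b \<in> U" for a b
  proof -
    obtain m n where "a \<in> A m" "b \<in> A n"
      using ab unfolding U_def by blast
    then have "a \<in> A (max m n)" "b \<in> A (max m n)"
      using mono[of m "max m n"] mono[of n "max m n"] by auto
    then show ?thesis by blast
  qed
  note A_closed = adjoin_closed[where S = "S \<union> f ` {..<n}" for n, folded A_def]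
  have "adjoin (S \<union> range f) \<subseteq> U"
  proof (rule adjoin_least)
    show "is_subfield U"
      unfolding is_subfield_def
    proof (intro conjI ballI)
      show "0 \<in> U" "1 \<in> U"
        by (rule UI, rule A_closed)+
      fix a b assume "a \<in> U" "b \<in> U"
      then obtain n where "a \<in> A n" "b \<in> A n"
        using common by blast
      then show "a + b \<in> U" "a * b \<in> U" "- a \<in> U" "inverse a \<in> U"
        by (auto intro: UI[of _ n] A_closed)
    qed
    show "range const \<subseteq> U"
      using UI[of _ 0] const_in_adjoin by (auto simp: A_def)
    have "f i \<in> A (Suc i)" for i
      unfolding A_def by (rule subsetD[OF adjoin_superset]) simp
    moreover have "a \<in> A 0" if "a \<in> S" for a
      unfolding A_def by (rule subsetD[OF adjoin_superset]) (use that in simp)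
    ultimately show "S \<union> range f \<subseteq> U"
      using UI by auto
  qed
  then show thesis
    using assms that unfolding U_def A_def by blast
qed

text \<open>The quotients of values at \<open>t\<close> form a subfield containing the generators.
  As \<open>t\<close> may be algebraic over \<open>adjoin S\<close>, the denominator has to be
  nonzero at \<open>t\<close>, not merely as a polynomial.\<close>

lemma adjoin_insert:
  assumes "p \<in> adjoin (insert t S)"
  obtains a b where "\<And>i. coeff a i \<in> adjoin S" "\<And>i. coeff b i \<in> adjoin S"
    "poly b t \<noteq> 0" "p = poly a t / poly b t"
proof -
  define R where "R = {q. \<forall>i. coeff q i \<in> adjoin S}"
  define Q where "Q = {poly a t / poly b t | a b. a \<in> R \<and> b \<in> R \<and> poly b t \<noteq> 0}"
  have R: "a + b \<in> R" "a * b \<in> R" "- a \<in> R" if "a \<in> R" "b \<in> R" for a b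
    using that
    by (auto simp: R_def coeff_mult intro!: is_subfield_sum is_subfield_adjoin adjoin_closed(3-5))
  have R_const: "[:c:] \<in> R" if "c \<in> adjoin S" for c
    using that by (simp add: R_def coeff_pCons adjoin_closed(1) split: nat.split)
  have R_t: "[:0, 1:] \<in> R"
    by (simp add: R_def coeff_pCons adjoin_closed(1,2) split: nat.split)
  have QI: "poly a t / poly b t \<in> Q" if "a \<in> R" "b \<in> R" "poly b t \<noteq> 0" for a b
    using that unfolding Q_def by blast
  have Q_poly: "poly a t \<in> Q" if "a \<in> R" for a
    using QI[OF that R_const[of 1]] by (simp add: adjoin_closed(2))
  have "adjoin (insert t S) \<subseteq> Q"
  proof (rule adjoin_least)
    have "0 \<in> Q" "1 \<in> Q"
      using Q_poly[OF R_const[of 0]] Q_poly[OF R_const[of 1]] by (simp_all add: adjoin_closed(1,2))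
    moreover have "u + v \<in> Q" "u * v \<in> Q" if uQ: "u \<in> Q" and vQ: "v \<in> Q" for u v
    proof -
      obtain a b where u: "u = poly a t / poly b t" "a \<in> R" "b \<in> R" "poly b t \<noteq> 0"
        using uQ unfolding Q_def by blast
      obtain c d where v: "v = poly c t / poly d t" "c \<in> R" "d \<in> R" "poly d t \<noteq> 0"
        using vQ unfolding Q_def by blast
      have "u + v = poly (a * d + c * b) t / poly (b * d) t"
        using u v by (simp add: add_frac_eq)
      then show "u + v \<in> Q"
        using QI[of "a * d + c * b" "b * d"] u v R by simp
      have "u * v = poly (a * c) t / poly (b * d) t"
        using u v by simp
      then show "u * v \<in> Q"
        using QI[of "a * c" "b * d"] u v R by simp
    qed
    moreover have "- u \<in> Q" "inverse u \<in> Q" if uQ: "u \<in> Q" for u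
    proof -
      obtain a b where u: "u = poly a t / poly b t" "a \<in> R" "b \<in> R" "poly b t \<noteq> 0"
        using uQ unfolding Q_def by blast
      show "- u \<in> Q"
        using QI[of "- a" b] u R by simp
      \<comment> \<open>If the numerator vanishes at \<open>t\<close>, then \<open>u\<close> is 0
        and its inverse is 0 by convention.\<close>
      show "inverse u \<in> Q"
        using QI[of b a] u \<open>0 \<in> Q\<close> by (cases "poly a t = 0") simp_all
    qed
    ultimately show "is_subfield Q"
      by (simp add: is_subfield_def)
    show "range const \<subseteq> Q"
      using Q_poly[OF R_const] const_in_adjoin by fastforce
    show "insert t S \<subseteq> Q"
      using Q_poly[OF R_t] Q_poly[OF R_const] adjoin_superset[of S] by auto
  qed
  then show thesis
    using assms that unfolding Q_def R_def by blast
qed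


section \<open>Homomorphisms and derivations on subfields\<close>

lemma is_alg_homD:
  assumes "is_alg_hom h"
  shows "h (a + b) = h a + h b" "h (a * b) = h a * h b" "h (const c) = const c"
    "h 0 = 0" "h 1 = 1" "h (- a) = - h a" "h (inverse a) = inverse (h a)"
    "h (a / b) = h a / h b"
proof -
  show h: "h (a + b) = h a + h b" "h (a * b) = h a * h b" "h (const c) = const c" for a b c
    using assms by (simp_all add: is_alg_hom_def)
  show h0: "h 0 = 0" and h1: "h 1 = 1"
    using h(3)[of 0] h(3)[of 1] by simp_all
  show "h (- a) = - h a"
    using h(1)[of a "- a"] h0 by (simp add: eq_neg_iff_add_eq_0 add.commute)
  show inv: "h (inverse a) = inverse (h a)" for a
  proof (cases "a = 0")
    case False
    then have "h a * h (inverse a) = 1"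
      using h1 by (simp flip: h(2))
    then show ?thesis by (metis inverse_unique)
  qed (simp add: h0)
  show "h (a / b) = h a / h b"
    by (simp add: divide_inverse h inv)
qed

lemma is_derivationD:
  assumes "is_derivation D"
  shows "D (a + b) = D a + D b" "D (a * b) = D a * b + a * D b" "D (const c) = 0"
    "D 0 = 0" "D 1 = 0" "D (- a) = - D a" "D (inverse a) = - D a * inverse a * inverse a"
proof -
  show D: "D (a + b) = D a + D b" "D (a * b) = D a * b + a * D b" "D (const c) = 0" for a b c
    using assms by (simp_all add: is_derivation_def)
  show D0: "D 0 = 0" and D1: "D 1 = 0"
    using D(3)[of 0] D(3)[of 1] by simp_all
  show "D (- a) = - D a"
    using D(1)[of a "- a"] D0 by (simp add: eq_neg_iff_add_eq_0 add.commute)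
  show "D (inverse a) = - D a * inverse a * inverse a"
  proof (cases "a = 0")
    case False
    then have "D a * inverse a + a * D (inverse a) = 0"
      using D1 by (simp flip: D(2))
    then have "a * D (inverse a) = - D a * inverse a"
      by (simp add: eq_neg_iff_add_eq_0 add.commute)
    then have "D (inverse a) = - D a * inverse a / a"
      using False by (metis nonzero_mult_div_cancel_left)
    then show ?thesis
      by (simp add: divide_inverse)
  qed (simp add: D0)
qed

section \<open>Passing from generators to generated fields\<close>

lemma alg_hom_in_adjoin:
  assumes "is_alg_hom h" "p \<in> adjoin S" "\<And>a. a \<in> S \<Longrightarrow> h a \<in> adjoin T"
  shows "h p \<in> adjoin T"
proof -
  have "adjoin S \<subseteq> {a. h a \<in> adjoin T}"
    by (rule adjoin_least)
      (use assms(3) in \<open>auto simp: is_subfield_def is_alg_homD[OF assms(1)] const_in_adjoin intro!: adjoin_closed\<close>)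
  then show ?thesis using assms(2) by blast
qed

text \<open>The product rule involves the elements as well as their derivatives, so the subfield
  used here is cut out by both memberships.\<close>

lemma derivation_in_adjoin:
  assumes "is_derivation D" "p \<in> adjoin S"
    and "\<And>a. a \<in> S \<Longrightarrow> a \<in> adjoin T" "\<And>a. a \<in> S \<Longrightarrow> D a \<in> adjoin T"
  shows "D p \<in> adjoin T"
proof -
  have "adjoin S \<subseteq> {a \<in> adjoin T. D a \<in> adjoin T}"
    by (rule adjoin_least)
      (use assms(3,4) in \<open>auto simp: is_subfield_def is_derivationD[OF assms(1)] const_in_adjoin intro!: adjoin_closed\<close>)
  then show ?thesis using assms(2) by blast
qed

lemma derivation_adjoin_eq_0:
  assumes "is_derivation D" "p \<in> adjoin S" "\<And>a. a \<in> S \<Longrightarrow> D a = 0"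
  shows "D p = 0"
proof -
  have "adjoin S \<subseteq> {a. D a = 0}"
    by (rule adjoin_least)
      (use assms(3) in \<open>auto simp: is_subfield_def is_derivationD[OF assms(1)]\<close>)
  then show ?thesis using assms(2) by blast
qed

section \<open>Transcendence over the constants of a derivation\<close>

lemma derivation_poly:
  assumes "is_derivation D" "\<And>i. D (coeff q i) = 0" "D t = 1"
  shows "D (poly q t) = poly (pderiv q) t"
  using assms(2)
proof (induction q)
  case (pCons a q)
  have "D a = 0" "D (coeff q i) = 0" for i
    using pCons.prems[of 0] pCons.prems[of "Suc i"] by simp_all
  then show ?case
    using pCons.IH assms(3) by (simp add: is_derivationD[OF assms(1)] pderiv_pCons)
qed (simp add: is_derivationD[OF assms(1)])

text \<open>Applying \<open>D\<close> to a relation q(t) = 0 with constant coefficients gives q'(t)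
  = 0, of lower degree. By induction q' = 0, which in characteristic zero is impossible for q of
  positive degree.\<close>

lemma transcendental_over_constants:
  assumes "is_derivation D" "D t = 1" "\<And>i. D (coeff q i) = 0" "poly q t = 0"
  shows "q = 0"
  using assms(3,4)
proof (induction "degree q" arbitrary: q)
  case 0
  then obtain c where "q = [:c:]" by (metis degree_eq_zeroE)
  then show ?case using 0 by simp
next
  case (Suc n)
  \<comment> \<open>The coefficients of \<open>pderiv q\<close> carry natural number factors, which
    must be constants as well.\<close>
  have of_nat: "D (of_nat k) = 0" for k
    by (induction k) (simp_all add: is_derivationD[OF assms(1)])
  have "pderiv q = 0"
  proof (rule Suc.hyps(1))
    show "n = degree (pderiv q)"
      using Suc.hyps(2) by (simp add: degree_pderiv)
    show "D (coeff (pderiv q) i) = 0" for i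
      by (simp only: coeff_pderiv is_derivationD(2)[OF assms(1)] of_nat Suc.prems(1)) simp
    show "poly (pderiv q) t = 0"
      unfolding derivation_poly[OF assms(1) Suc.prems(1) assms(2), symmetric] Suc.prems(2)
      by (rule is_derivationD(4)[OF assms(1)])
  qed
  then show ?case
    using Suc.hyps(2) by (simp add: pderiv_eq_0_iff)
qed

text \<open>Writing p = a(t)/b(t) makes \<open>t\<close> a root of a - p b, whose coefficients are
  killed by \<open>D\<close> because \<open>D p = 0\<close>. Hence a = p b, and \<open>p\<close> is
  a quotient of coefficients of a and b.\<close>

lemma constant_in_adjoin_insert:
  assumes D: "is_derivation D" "D t = 1" "\<And>a. a \<in> S \<Longrightarrow> D a = 0"
    and p: "p \<in> adjoin (insert t S)" "D p = 0"
  shows "p \<in> adjoin S"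
proof -
  obtain a b where ab: "\<And>i. coeff a i \<in> adjoin S" "\<And>i. coeff b i \<in> adjoin S"
    "poly b t \<noteq> 0" "p = poly a t / poly b t"
    using adjoin_insert[OF p(1)] by blast
  have ab0: "D (coeff a i) = 0" "D (coeff b i) = 0" for i
    using derivation_adjoin_eq_0[OF D(1)] D(3) ab(1,2) by blast+
  have "a + smult (- p) b = 0"
  proof (rule transcendental_over_constants[OF D(1,2)])
    show "D (coeff (a + smult (- p) b) i) = 0" for i
      by (simp only: coeff_add coeff_smult is_derivationD[OF D(1)] ab0 p(2)) simp
    show "poly (a + smult (- p) b) t = 0"
      using ab(3,4) by simp
  qed
  then have "a = smult p b"
    by (simp add: eq_neg_iff_add_eq_0)
  then have "coeff a (degree b) = p * lead_coeff b"
    by simp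
  moreover have "lead_coeff b \<noteq> 0"
    using ab(3) by auto
  ultimately have "p = coeff a (degree b) / lead_coeff b"
    by simp
  then show ?thesis
    using adjoin_closed(7)[OF ab(1,2)] by metis
qed


section \<open>Invariance of the curvatures\<close>

lemma partial_derivation: "is_derivation partial" and chi_derivation: "is_derivation chi"
  and Lam_alg_hom: "is_alg_hom Lam"
  using partial_props chi_props Lam_props by auto

lemma x_jet_in_F: "x_jet i \<in> F" and y_jet_in_F: "y_jet i \<in> F"
  using adjoin_superset[of "range x_jet \<union> range y_jet"] by (auto simp: F_def)

lemmas F_closed = adjoin_closed[where S = "range x_jet \<union> range y_jet", folded F_def]

lemma x_jet_nonzero: "x_jet i \<noteq> 0" and phi_jet_nonzero: "phi_jet i \<noteq> 0"
  by (simp_all add: x_jet_def phi_jet_def)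

lemma partial_in_F: "p \<in> F \<Longrightarrow> partial p \<in> F"
  unfolding F_def
  by (erule derivation_in_adjoin[OF partial_derivation])
    (use partial_props x_jet_in_F y_jet_in_F in \<open>auto simp: F_def\<close>)

text \<open>The difference of the two sides is a derivation that vanishes at the generators of
  \<open>F\<close>. It does not vanish on \<open>L\<close>: at \<open>phi_jet i\<close> the two
  sides differ by the factor \<open>phi_jet 1\<close>.\<close>

lemma chi_on_F: "p \<in> F \<Longrightarrow> chi p = phi_jet 1 * partial p"
proof -
  assume p: "p \<in> F"
  have "is_derivation (\<lambda>a. chi a - phi_jet 1 * partial a)"
    by (simp add: is_derivation_def is_derivationD[OF partial_derivation]
        is_derivationD[OF chi_derivation] algebra_simps)
  then have "chi p - phi_jet 1 * partial p = 0"
    by (rule derivation_adjoin_eq_0) (use p partial_props chi_props in \<open>auto simp: F_def\<close>)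
  then show ?thesis by simp
qed

text \<open>Both sides obey the same product rule twisted by \<open>Lam\<close>, so they agree on a
  subfield. At \<open>x_jet i\<close> both are \<open>(chi ^^ Suc i) (x_jet 0)\<close>, and likewise
  at \<open>y_jet i\<close>.\<close>

lemma Lam_partial:
  assumes "p \<in> F"
  shows "Lam (partial p) = chi (Lam p)"
proof -
  have "F \<subseteq> {a. Lam (partial a) = chi (Lam a)}"
    unfolding F_def
    by (rule adjoin_least)
      (use partial_props Lam_props in \<open>auto simp: is_subfield_def is_derivationD[OF partial_derivation]
        is_derivationD[OF chi_derivation] is_alg_homD[OF Lam_alg_hom]\<close>)
  then show ?thesis using assms by blast
qed

lemma Lam_jets:
  "Lam (x_jet 0) = x_jet 0" "Lam (y_jet 0) = y_jet 0"
  "Lam (x_jet 1) = x_jet 1 * phi_jet 1" "Lam (y_jet 1) = y_jet 1 * phi_jet 1"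
  using Lam_props chi_props by simp_all

lemma is_subfield_I_F: "is_subfield I_F"
  by (auto simp: is_subfield_def I_F_def is_alg_homD[OF Lam_alg_hom] intro: F_closed)

text \<open>\<open>Lam\<close> multiplies both \<open>partial p\<close> and \<open>x_jet 1\<close>
  by \<open>phi_jet 1\<close>, which cancels in the quotient.\<close>

lemma partial_over_x_in_I_F:
  assumes "p \<in> I_F"
  shows "partial p / x_jet 1 \<in> I_F"
proof -
  have p: "p \<in> F" "Lam p = p"
    using assms by (auto simp: I_F_def)
  then have "Lam (partial p) = phi_jet 1 * partial p"
    by (simp add: Lam_partial chi_on_F)
  then show ?thesis
    using p partial_in_F x_jet_in_F
    by (simp add: I_F_def is_alg_homD[OF Lam_alg_hom] Lam_jets F_closed phi_jet_nonzero
        del: One_nat_def)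
qed

text \<open>The defining recursion starts at \<open>kappa 1\<close>; the quotient rule extends it
  down to the slope, so that one step serves all indices.\<close>

lemma kappa_Suc: "kappa (Suc i) = partial (kappa i) / x_jet 1"
proof (cases i)
  case 0
  have "partial (y_jet 1 / x_jet 1) =
      y_jet 2 / x_jet 1 - y_jet 1 * x_jet 2 / x_jet 1 ^ 2"
    using partial_props
    by (simp add: divide_inverse is_derivationD[OF partial_derivation] power2_eq_square numeral_2_eq_2)
  also have "\<dots> = (y_jet 2 * x_jet 1 - y_jet 1 * x_jet 2) / x_jet 1 ^ 2"
    using x_jet_nonzero[of 1] by (simp add: diff_divide_distrib power2_eq_square)
  finally show ?thesis
    using x_jet_nonzero[of 1] by (simp add: 0 power2_eq_square power3_eq_cube)
qed simp

lemma kappa_in_I_F: "kappa i \<in> I_F"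
proof (induction i)
  case 0
  show ?case
    using x_jet_in_F y_jet_in_F
    by (simp add: I_F_def is_alg_homD[OF Lam_alg_hom] Lam_jets[unfolded One_nat_def] F_closed phi_jet_nonzero)
next
  case (Suc i)
  then show ?case
    unfolding kappa_Suc by (rule partial_over_x_in_I_F)
qed


section \<open>Elimination of the parametrization\<close>

abbreviation (input) curve_invs :: "L set" where
  "curve_invs \<equiv> {x_jet 0, y_jet 0} \<union> range kappa"

lemma curve_invs_subset_I_F: "curve_invs \<subseteq> I_F"
  using kappa_in_I_F x_jet_in_F y_jet_in_F Lam_jets by (auto simp: I_F_def)

text \<open>The field on the right is closed under \<open>partial\<close>: this sends
  \<open>y_jet 0\<close> to \<open>kappa 0 * x_jet 1\<close> and \<open>kappa i\<close> to
  \<open>kappa (Suc i) * x_jet 1\<close>. Repeated application to \<open>y_jet 0\<close> yields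
  every \<open>y_jet i\<close>.\<close>

lemma F_subset_adjoin_curve_invs_x: "F \<subseteq> adjoin (curve_invs \<union> range (\<lambda>i. x_jet (Suc i)))"
proof -
  let ?S = "curve_invs \<union> range (\<lambda>i. x_jet (Suc i))"
  have S: "a \<in> adjoin ?S" if "a \<in> ?S" for a
    by (rule subsetD[OF adjoin_superset that])
  have x: "x_jet i \<in> adjoin ?S" for i
    by (rule S) (cases i; simp)
  have kappa: "kappa i \<in> adjoin ?S" for i
    by (rule S) simp
  have "y_jet 1 = kappa 0 * x_jet 1"
    using x_jet_nonzero by simp
  then have y1: "y_jet 1 \<in> adjoin ?S"
    using adjoin_closed(4)[OF kappa x] by (simp only:)
  have partial_kappa: "partial (kappa i) = kappa (Suc i) * x_jet 1" for i
    unfolding kappa_Suc using x_jet_nonzero by simp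
  have D: "partial a \<in> adjoin ?S" if "a \<in> adjoin ?S" for a
  proof (rule derivation_in_adjoin[OF partial_derivation that S])
    fix a assume "a \<in> ?S"
    then consider i where "a = x_jet i" | "a = y_jet 0" | i where "a = kappa i"
      by blast
    then show "partial a \<in> adjoin ?S"
    proof cases
      case 1
      then show ?thesis using partial_props x by simp
    next
      case 2
      then show ?thesis using partial_props y1 by simp
    next
      case 3
      show ?thesis
        unfolding 3 partial_kappa by (rule adjoin_closed(4)[OF kappa x])
    qed
  qed
  have y: "y_jet i \<in> adjoin ?S" for i
  proof (induction i)
    case (Suc i)
    then show ?case using D[of "y_jet i"] partial_props by simp
  qed (rule S, simp)
  show ?thesis
    unfolding F_def using x y by (intro adjoin_subset_adjoin) auto
qed

text \<open>The images are triangular in the \<open>phi_jet\<close> variables: each step applies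
  \<open>chi\<close>, and only the leading term produces the next variable, again with coefficient
  \<open>x_jet 1\<close>.\<close>

lemma Lam_x_jet_Suc:
  "\<exists>r \<in> adjoin (range x_jet \<union> phi_jet ` {..n}).
     Lam (x_jet (Suc n)) = x_jet 1 * phi_jet (Suc n) + r"
proof (induction n)
  case 0
  show ?case
    using adjoin_closed(1) Lam_jets(3) by (intro bexI[of _ 0]) auto
next
  case (Suc n)
  let ?G = "adjoin (range x_jet \<union> phi_jet ` {..Suc n})"
  obtain r where r: "r \<in> adjoin (range x_jet \<union> phi_jet ` {..n})"
    "Lam (x_jet (Suc n)) = x_jet 1 * phi_jet (Suc n) + r"
    using Suc by blast
  have G: "x_jet i \<in> ?G" "j \<le> Suc n \<Longrightarrow> phi_jet j \<in> ?G" for i j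
    by (rule subsetD[OF adjoin_superset], simp)+
  \<comment> \<open>\<open>chi\<close> raises the index of a \<open>phi_jet\<close> by one and turns
    \<open>x_jet i\<close> into \<open>x_jet (Suc i) * phi_jet 1\<close>; the bound
    \<open>Suc n\<close> leaves room for both.\<close>
  have "chi r \<in> ?G"
    by (rule derivation_in_adjoin[OF chi_derivation r(1)])
      (use G chi_props in \<open>auto intro!: adjoin_closed(4)\<close>)
  then have "x_jet 2 * phi_jet 1 * phi_jet (Suc n) + chi r \<in> ?G"
    by (intro adjoin_closed(3,4) G) simp_all
  moreover have "Lam (x_jet (Suc (Suc n))) = chi (x_jet 1 * phi_jet (Suc n) + r)"
    using Lam_partial[OF x_jet_in_F, of "Suc n"] partial_props r(2) by simp
  then have "Lam (x_jet (Suc (Suc n))) =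
      x_jet 1 * phi_jet (Suc (Suc n)) + (x_jet 2 * phi_jet 1 * phi_jet (Suc n) + chi r)"
    using chi_props by (simp add: is_derivationD[OF chi_derivation] numeral_2_eq_2)
  ultimately show ?case
    by blast
qed

lemma eliminate_parametrization:
  assumes "p \<in> F" "p \<in> adjoin (curve_invs \<union> (\<lambda>i. Lam (x_jet (Suc i))) ` {..<n})"
  shows "p \<in> adjoin curve_invs"
  using assms(2)
proof (induction n)
  case (Suc n)
  define X where "X i = Lam (x_jet (Suc i))" for i
  \<comment> \<open>\<open>X n\<close> is the image of \<open>x_jet (Suc n)\<close>, so its leading
    variable is \<open>phi_jet (Suc n)\<close>. The factor \<open>inverse (x_jet 1)\<close>
    normalizes \<open>E (X n)\<close> to 1.\<close>
  obtain E where E: "is_derivation E"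
    "\<And>v. E (gen v) = (if v = Vphi (Suc n) then inverse (x_jet 1) else 0)"
    using derivation_ex1[of "\<lambda>v. if v = Vphi (Suc n) then inverse (x_jet 1) else 0"] by blast
  have E_jets: "E (x_jet i) = 0" "E (y_jet i) = 0"
    "E (phi_jet i) = (if i = Suc n then inverse (x_jet 1) else 0)" for i
    by (simp_all add: x_jet_def y_jet_def phi_jet_def E(2))
  have E_F: "E a = 0" if "a \<in> F" for a
    by (rule derivation_adjoin_eq_0[OF E(1) that[unfolded F_def]]) (auto simp: E_jets)
  have E_G: "E r = 0" if "r \<in> adjoin (range x_jet \<union> phi_jet ` {..i})" "i \<le> n" for r i
    by (rule derivation_adjoin_eq_0[OF E(1) that(1)]) (use that(2) in \<open>auto simp: E_jets\<close>)
  have E_X: "E (X i) = (if i = n then 1 else 0)" if "i \<le> n" for i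
  proof -
    obtain r where "r \<in> adjoin (range x_jet \<union> phi_jet ` {..i})"
      "X i = x_jet 1 * phi_jet (Suc i) + r"
      using Lam_x_jet_Suc unfolding X_def by blast
    then show ?thesis
      using E_G that x_jet_nonzero by (simp add: is_derivationD[OF E(1)] E_jets)
  qed
  have "p \<in> adjoin (insert (X n) (curve_invs \<union> X ` {..<n}))"
    using Suc.prems by (simp add: X_def lessThan_Suc)
  then have "p \<in> adjoin (curve_invs \<union> X ` {..<n})"
  proof (rule constant_in_adjoin_insert[OF E(1), rotated 2])
    show "E (X n) = 1" "E p = 0"
      using E_X E_F assms(1) by simp_all
    show "E a = 0" if "a \<in> curve_invs \<union> X ` {..<n}" for a
      using that E_X E_F curve_invs_subset_I_F by (auto simp: I_F_def)
  qed
  then show ?case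
    by (intro Suc.IH) (simp add: X_def)
qed simp

theorem theorem2p5:
  shows "I_F = adjoin ({x_jet 0, y_jet 0} \<union> range kappa)"
proof
  have "const c \<in> I_F" for c
    using const_in_adjoin by (auto simp: I_F_def F_def is_alg_homD[OF Lam_alg_hom])
  then show "adjoin curve_invs \<subseteq> I_F"
    using curve_invs_subset_I_F is_subfield_I_F by (intro adjoin_least) auto
  show "I_F \<subseteq> adjoin curve_invs"
  proof
    fix p assume "p \<in> I_F"
    then have p: "p \<in> F" "Lam p = p" by (auto simp: I_F_def)
    let ?T = "curve_invs \<union> range (\<lambda>i. Lam (x_jet (Suc i)))"
    \<comment> \<open>Applying \<open>Lam\<close> to an expression of \<open>p\<close> in the
      generators fixes the curve invariants and replaces each \<open>x_jet (Suc i)\<close> by its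
      image; by invariance the result is still \<open>p\<close>.\<close>
    have "Lam p \<in> adjoin ?T"
    proof (rule alg_hom_in_adjoin[OF Lam_alg_hom])
      show "p \<in> adjoin (curve_invs \<union> range (\<lambda>i. x_jet (Suc i)))"
        using p F_subset_adjoin_curve_invs_x by blast
      fix a assume "a \<in> curve_invs \<union> range (\<lambda>i. x_jet (Suc i))"
      then have "Lam a \<in> ?T"
        using curve_invs_subset_I_F by (auto simp: I_F_def)
      then show "Lam a \<in> adjoin ?T"
        by (rule subsetD[OF adjoin_superset])
    qed
    then have "p \<in> adjoin ?T"
      by (simp only: p)
    then show "p \<in> adjoin curve_invs"
      by (rule adjoin_union_range_finite) (rule eliminate_parametrization[OF p(1)])
  qed
qed

end
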